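(* Let $T>0$, $b\in\mathbb{R}$, and let $W^{\rm av}$, $W^{\rm ir}$, $W^{\rm st}$ be the anticipative version, the integral representation and the space-time transform of the Wiener bridge from $0$ to $b$ over the time-interval $[0,T]$, all constructed from the same standard Wiener process $W$. Then for all $t\in(0,T)$, $$\mathbb{E}\left(|W_t-W_t^{\rm av}|\right)=\mathbb{E}\left(|W_t-W_t^{\rm st}|\right)>\mathbb{E}\left(|W_t-W_t^{\rm ir}|\right).$$
   Context: $(W_t)_{t\ge 0}$ is a standard one-dimensional Wiener process. For $T>0$ and $b\in\mathbb{R}$, the following three versions of the Wiener bridge from $0$ to $b$ over $[0,T]$ are considered, all built from this same $W$: Anticipative version: $W_t^{\rm av}=b\frac{t}{T}+\left(W_t-\frac{t}{T}W_T\right)$ for $0\le t\le T$. Integral representation: $W_t^{\rm ir}=b\frac{t}{T}+\int_0^t\frac{T-t}{T-s}\,\mathrm{d}W_s$ for $0\le t<T$, and $W_T^{\rm ir}=b$. Space-time transform: $W_t^{\rm st}=b\frac{t}{T}+\frac{T-t}{T}W_{\frac{tT}{T-t}}$ for $0\le t<T$, and $W_T^{\rm st}=b$. *)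

theory Defs
  imports "HOL-Probability.Probability"
begin

text \<open>The index set of the process is \<open>[0, \<infinity>)\<close>; the values of \<open>W\<close> at negative times are irrelevant.
  The second parameter of \<^const>\<open>normal_density\<close> is the standard deviation.\<close>

locale standard_wiener_process = prob_space M
  for M :: "'a measure" +
  fixes W :: "real \<Rightarrow> 'a \<Rightarrow> real"
  assumes wiener_measurable: "\<And>t. 0 \<le> t \<Longrightarrow> W t \<in> borel_measurable M"
    and wiener_zero: "AE \<omega> in M. W 0 \<omega> = 0"
    and wiener_indep_increments:
      "\<And>(n::nat) (\<tau>::nat \<Rightarrow> real). 0 \<le> \<tau> 0 \<Longrightarrow> (\<forall>i<n. \<tau> i \<le> \<tau> (Suc i)) \<Longrightarrow>
        indep_vars (\<lambda>_. borel) (\<lambda>i \<omega>. W (\<tau> (Suc i)) \<omega> - W (\<tau> i) \<omega>) {..<n}"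
    and wiener_normal_increments:
      "\<And>s t. 0 \<le> s \<Longrightarrow> s < t \<Longrightarrow>
        distributed M lborel (\<lambda>\<omega>. W t \<omega> - W s \<omega>) (normal_density 0 (sqrt (t - s)))"
    and wiener_continuous_paths: "AE \<omega> in M. continuous_on {0..} (\<lambda>t. W t \<omega>)"

definition partition_of :: "real \<Rightarrow> nat \<Rightarrow> (nat \<Rightarrow> real) \<Rightarrow> bool" where
  "partition_of t n p \<longleftrightarrow> p 0 = 0 \<and> p n = t \<and> (\<forall>i<n. p i \<le> p (Suc i))"

definition step_function :: "nat \<Rightarrow> (nat \<Rightarrow> real) \<Rightarrow> (nat \<Rightarrow> real) \<Rightarrow> real \<Rightarrow> real" where
  "step_function n p c s = (\<Sum>i<n. c i * indicator {p i<..p (Suc i)} s)"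

definition step_integral ::
    "(real \<Rightarrow> 'a \<Rightarrow> real) \<Rightarrow> nat \<Rightarrow> (nat \<Rightarrow> real) \<Rightarrow> (nat \<Rightarrow> real) \<Rightarrow> 'a \<Rightarrow> real" where
  "step_integral W n p c \<omega> = (\<Sum>i<n. c i * (W (p (Suc i)) \<omega> - W (p i) \<omega>))"

text \<open>\<open>has_wiener_integral M W t f I\<close> says that the random variable \<open>I\<close> is a version of the
  stochastic integral \<open>\<integral>\<^sub>0\<^sup>t f(s) dW\<^sub>s\<close> of the deterministic integrand \<open>f\<close>, i.e. the limit in
  \<open>L\<^sup>2(M)\<close> of the integrals of step functions converging to \<open>f\<close> in \<open>L\<^sup>2[0,t]\<close>. By the Ito isometry
  the limit depends, up to almost sure equality, only on \<open>f\<close>. It is a relation, since the integral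
  is determined only almost surely. The squared \<open>L\<^sup>2\<close> distances are taken in \<^typ>\<open>ennreal\<close>, so that no
  non-integrable function is silently assigned the integral \<open>0\<close>.\<close>

definition has_wiener_integral ::
    "'a measure \<Rightarrow> (real \<Rightarrow> 'a \<Rightarrow> real) \<Rightarrow> real \<Rightarrow> (real \<Rightarrow> real) \<Rightarrow> ('a \<Rightarrow> real) \<Rightarrow> bool" where
  "has_wiener_integral M W t f I \<longleftrightarrow>
     set_borel_measurable lborel {0..t} f \<and> I \<in> borel_measurable M \<and>
     (\<exists>(n::nat \<Rightarrow> nat) (p::nat \<Rightarrow> nat \<Rightarrow> real) (c::nat \<Rightarrow> nat \<Rightarrow> real).
        (\<forall>k. partition_of t (n k) (p k)) \<and>
        (\<lambda>k. \<integral>\<^sup>+s\<in>{0..t}. ennreal ((step_function (n k) (p k) (c k) s - f s)\<^sup>2) \<partial>lborel)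
          \<longlonglongrightarrow> 0 \<and>
        (\<lambda>k. \<integral>\<^sup>+\<omega>. ennreal ((step_integral W (n k) (p k) (c k) \<omega> - I \<omega>)\<^sup>2) \<partial>M)
          \<longlonglongrightarrow> 0)"

definition bridge_av :: "real \<Rightarrow> real \<Rightarrow> (real \<Rightarrow> 'a \<Rightarrow> real) \<Rightarrow> real \<Rightarrow> 'a \<Rightarrow> real" where
  "bridge_av T b W t \<omega> = b * (t / T) + (W t \<omega> - t / T * W T \<omega>)"

definition bridge_st :: "real \<Rightarrow> real \<Rightarrow> (real \<Rightarrow> 'a \<Rightarrow> real) \<Rightarrow> real \<Rightarrow> 'a \<Rightarrow> real" where
  "bridge_st T b W t \<omega> =
     (if t < T then b * (t / T) + (T - t) / T * W (t * T / (T - t)) \<omega> else b)"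

text \<open>A relation rather than a function, as the stochastic integral is determined only almost
  surely. The integrand depends on the upper limit \<open>t\<close> of integration as well.\<close>

definition is_bridge_ir ::
    "'a measure \<Rightarrow> real \<Rightarrow> real \<Rightarrow> (real \<Rightarrow> 'a \<Rightarrow> real) \<Rightarrow> (real \<Rightarrow> 'a \<Rightarrow> real) \<Rightarrow> bool" where
  "is_bridge_ir M T b W X \<longleftrightarrow>
     (\<forall>t. 0 \<le> t \<and> t < T \<longrightarrow>
        (\<exists>I. has_wiener_integral M W t (\<lambda>s. (T - t) / (T - s)) I \<and>
             (\<forall>\<omega>\<in>space M. X t \<omega> = b * (t / T) + I \<omega>))) \<and>
     (\<forall>\<omega>\<in>space M. X T \<omega> = b)"

end

theory Submission
  imports Defs
begin

text \<open>
  The difference between \<open>W\<^sub>t\<close> and each version of the bridge is Gaussian with mean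
  \<open>- b t / T\<close>, so the claim is a comparison of variances: for fixed \<open>m\<close> the absolute moment \<open>E \<bar>m + \<sigma> Z\<bar>\<close> of a
  standard normal variable \<open>Z\<close> is strictly increasing in \<open>\<sigma> \<ge> 0\<close>
  (\<open>std_normal_abs_moment_strict_mono\<close>).

  The anticipative and the space-time version need only finitely many increments of \<open>W\<close>. Up to the
  mean, the first difference is \<open>(t/T) W\<^sub>T\<close>; with \<open>u = t T / (T - t)\<close> the second one is
  \<open>(t/T) W\<^sub>t - ((T - t)/T) (W\<^sub>u - W\<^sub>t)\<close>. Both have variance \<open>t\<^sup>2 / T\<close>. Such combinations are Wiener
  integrals of step functions, whose law is found from characteristic functions
  (\<open>distr_step_integral\<close>).

  For the integral representation the difference is, up to the mean, the Wiener integral over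
  \<open>[0, t]\<close> of \<open>1 - (T - t)/(T - s) = (t - s)/(T - s)\<close>. This integrand lies between \<open>0\<close> and \<open>t/T\<close>,
  so the variance is at most \<open>t\<^sup>3 / T\<^sup>2 < t\<^sup>2 / T\<close>. The bound is carried over to the absolute moment
  along the approximating step integrals: their variances are eventually below a number strictly
  between \<open>t\<^sup>3 / T\<^sup>2\<close> and \<open>t\<^sup>2 / T\<close>, and they converge in \<open>L\<^sup>1\<close>
  (\<open>abs_moment_wiener_integral_le\<close>).
\<close>

section \<open>Absolute moments of normal variables\<close>

lemma (in prob_space) char_distr_affine:
  assumes [measurable]: "X \<in> borel_measurable M"
  shows "char (distr M borel (\<lambda>\<omega>. m + c * X \<omega>)) u = iexp (u * m) * char (distr M borel X) (u * c)"
proof -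
  have "char (distr M borel (\<lambda>\<omega>. m + c * X \<omega>)) u = (CLINT \<omega>|M. iexp (u * m) * iexp (u * c * X \<omega>))"
    unfolding char_def by (subst integral_distr) (auto simp: exp_add[symmetric] algebra_simps)
  also have "\<dots> = iexp (u * m) * (CLINT \<omega>|M. iexp (u * c * X \<omega>))"
    by simp
  also have "(CLINT \<omega>|M. iexp (u * c * X \<omega>)) = char (distr M borel X) (u * c)"
    unfolding char_def by (subst integral_distr) auto
  finally show ?thesis .
qed

lemma char_std_normal_affine:
  "char (distr std_normal_distribution borel (\<lambda>z. m + \<sigma> * z)) u =
    iexp (u * m) * of_real (exp (- (u\<^sup>2 * \<sigma>\<^sup>2) / 2))"
proof -
  interpret real_distribution std_normal_distribution
    by (rule real_dist_normal_dist)
  have "distr std_normal_distribution borel (\<lambda>z. z) = std_normal_distribution"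
    by (rule distr_id2) simp
  with char_distr_affine[of "\<lambda>z. z" m \<sigma> u] show ?thesis
    by (simp add: char_std_normal_distribution power_mult_distrib)
qed

text \<open>Only \<open>\<sigma>\<^sup>2\<close> enters the characteristic function. So \<open>\<sigma>\<close> may be \<open>0\<close> or negative, and the symmetry
  of the normal law is a special case.\<close>

lemma (in prob_space) distr_eq_std_normal_affineI:
  assumes "X \<in> borel_measurable M"
    and "\<And>u. char (distr M borel X) u = iexp (u * m) * of_real (exp (- (u\<^sup>2 * \<sigma>\<^sup>2) / 2))"
  shows "distr M borel X = distr std_normal_distribution borel (\<lambda>z. m + \<sigma> * z)"
proof (rule Levy_uniqueness)
  interpret N: real_distribution std_normal_distribution
    by (rule real_dist_normal_dist)
  show "real_distribution (distr std_normal_distribution borel (\<lambda>z. m + \<sigma> * z))"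
    by (rule N.real_distribution_distr) simp
qed (use assms in \<open>auto simp: char_std_normal_affine\<close>)

definition std_normal_abs_moment :: "real \<Rightarrow> real \<Rightarrow> real" where
  "std_normal_abs_moment m \<sigma> = (\<integral>z. \<bar>m + \<sigma> * z\<bar> \<partial>std_normal_distribution)"

lemma integrable_std_normal_affine: "integrable std_normal_distribution (\<lambda>z. m + \<sigma> * z)"
proof -
  interpret real_distribution std_normal_distribution
    by (rule real_dist_normal_dist)
  show ?thesis
    using integrable_std_normal_distribution_moment[of 1] by simp
qed

lemma std_normal_abs_moment_nonneg: "0 \<le> std_normal_abs_moment m \<sigma>"
  by (simp add: std_normal_abs_moment_def)

lemma std_normal_abs_moment_uminus: "std_normal_abs_moment m (- \<sigma>) = std_normal_abs_moment m \<sigma>"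
proof -
  interpret real_distribution std_normal_distribution
    by (rule real_dist_normal_dist)
  have "distr std_normal_distribution borel (\<lambda>z. m + (- \<sigma>) * z) =
      distr std_normal_distribution borel (\<lambda>z. m + \<sigma> * z)"
    by (rule distr_eq_std_normal_affineI, simp, subst char_std_normal_affine, simp)
  then have "(\<integral>x. \<bar>x\<bar> \<partial>distr std_normal_distribution borel (\<lambda>z. m + (- \<sigma>) * z)) =
      (\<integral>x. \<bar>x\<bar> \<partial>distr std_normal_distribution borel (\<lambda>z. m + \<sigma> * z))"
    by simp
  then show ?thesis
    unfolding std_normal_abs_moment_def by (simp add: integral_distr)
qed

text \<open>As \<open>Z\<close> and \<open>- Z\<close> have the same law, \<open>E \<bar>m + \<tau> Z\<bar>\<close> is also the mean of any convex combination
  of \<open>\<bar>m + \<tau> Z\<bar>\<close> and \<open>\<bar>m - \<tau> Z\<bar>\<close>. The combination with weights \<open>(\<tau> \<plusminus> \<sigma>)/(2 \<tau>)\<close> dominates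
  \<open>\<bar>m + \<sigma> Z\<bar>\<close> by the triangle inequality, strictly so where \<open>m + \<tau> Z\<close> and \<open>m - \<tau> Z\<close> have
  opposite signs.\<close>

lemma std_normal_abs_moment_strict_mono:
  assumes "0 \<le> \<sigma>" and "\<sigma> < \<tau>"
  shows "std_normal_abs_moment m \<sigma> < std_normal_abs_moment m \<tau>"
proof -
  interpret real_distribution std_normal_distribution
    by (rule real_dist_normal_dist)
  define q where "q = (\<tau> + \<sigma>) / (2 * \<tau>)"
  have q: "0 < q" "q < 1"
    using assms by (auto simp: q_def field_simps)
  have q': "\<sigma> = q * \<tau> - (1 - q) * \<tau>"
    using assms by (simp add: q_def field_simps)
  define F where "F z = q * \<bar>m + \<tau> * z\<bar> + (1 - q) * \<bar>m + (- \<tau>) * z\<bar>" for z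
  \<comment> \<open>On \<open>A\<close> one has \<open>\<tau> z > \<bar>m\<bar>\<close>, so that \<open>m + \<tau> z > 0 > m - \<tau> z\<close>.\<close>
  define A where "A = {(\<bar>m\<bar> + 1) / \<tau> <..< (\<bar>m\<bar> + 2) / \<tau>}"
  have A: "A \<in> sets lborel"
    by (simp add: A_def)
  have split: "m + \<sigma> * z = q * (m + \<tau> * z) + (1 - q) * (m + (- \<tau>) * z)" for z
    unfolding q' by (simp add: algebra_simps)
  have F_abs: "F z = \<bar>q * (m + \<tau> * z)\<bar> + \<bar>(1 - q) * (m + (- \<tau>) * z)\<bar>" for z
    using q by (simp add: F_def abs_mult)
  have le: "\<bar>m + \<sigma> * z\<bar> \<le> F z" for z
    unfolding split F_abs by (rule abs_triangle_ineq)
  have less: "\<bar>m + \<sigma> * z\<bar> < F z" if "z \<in> A" for z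
  proof -
    have "\<bar>m\<bar> < \<tau> * z"
      using that assms by (auto simp: A_def field_simps)
    then have "0 < m + \<tau> * z" "m + (- \<tau>) * z < 0"
      by auto
    then have "0 < q * (m + \<tau> * z)" "(1 - q) * (m + (- \<tau>) * z) < 0"
      using q by (simp_all add: mult_pos_neg)
    then show ?thesis
      unfolding split F_abs by linarith
  qed
  have int: "integrable std_normal_distribution (\<lambda>z. \<bar>m + s * z\<bar>)" for s
    by (intro integrable_abs integrable_std_normal_affine)
  have F: "integrable std_normal_distribution F"
    unfolding F_def by (intro Bochner_Integration.integrable_add integrable_mult_right int)
  have "emeasure std_normal_distribution A \<noteq> 0"
  proof
    assume "emeasure std_normal_distribution A = 0"
    then have "A \<in> null_sets std_normal_distribution"
      by (auto simp: null_sets_def A_def)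
    then have "AE z in lborel. z \<in> A \<longrightarrow> std_normal_density z = 0"
      by (simp add: null_sets_density_iff)
    moreover have "std_normal_density z \<noteq> 0" for z
      using normal_density_pos[of 1 0 z] by simp
    ultimately have "AE z in lborel. z \<notin> A"
      by simp
    then have "emeasure lborel A = 0"
      using AE_iff_measurable[of A lborel "\<lambda>z. z \<notin> A"] A by simp
    then show False
      using assms by (simp add: A_def divide_right_mono field_simps)
  qed
  then have "(\<integral>z. \<bar>m + \<sigma> * z\<bar> \<partial>std_normal_distribution) < integral\<^sup>L std_normal_distribution F"
  proof (rule integral_less_AE[OF int F])
    show "A \<in> events" using A by simp
    show "AE z in std_normal_distribution. z \<in> A \<longrightarrow> \<bar>m + \<sigma> * z\<bar> \<noteq> F z"
      using less by (intro AE_I2) (metis less_irrefl)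
    show "AE z in std_normal_distribution. \<bar>m + \<sigma> * z\<bar> \<le> F z"
      using le by (intro AE_I2)
  qed
  also have "\<dots> = q * std_normal_abs_moment m \<tau> + (1 - q) * std_normal_abs_moment m (- \<tau>)"
    unfolding F_def std_normal_abs_moment_def
    by (subst Bochner_Integration.integral_add[OF integrable_mult_right[OF int] integrable_mult_right[OF int]])
       (simp only: integral_mult_right_zero)
  also have "\<dots> = std_normal_abs_moment m \<tau>"
    by (simp add: std_normal_abs_moment_uminus algebra_simps)
  finally show ?thesis
    by (simp add: std_normal_abs_moment_def)
qed

corollary std_normal_abs_moment_mono:
  "0 \<le> \<sigma> \<Longrightarrow> \<sigma> \<le> \<tau> \<Longrightarrow> std_normal_abs_moment m \<sigma> \<le> std_normal_abs_moment m \<tau>"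
  using std_normal_abs_moment_strict_mono[of \<sigma> \<tau> m] by (cases "\<sigma> = \<tau>") auto

section \<open>Step functions and their Wiener integrals\<close>

definition step_variance :: "nat \<Rightarrow> (nat \<Rightarrow> real) \<Rightarrow> (nat \<Rightarrow> real) \<Rightarrow> real" where
  "step_variance n p c = (\<Sum>i<n. (c i)\<^sup>2 * (p (Suc i) - p i))"

lemma partition_ofD:
  assumes "partition_of t n p"
  shows "p 0 = 0" and "p n = t" and "i < n \<Longrightarrow> p i \<le> p (Suc i)"
  using assms by (auto simp: partition_of_def)

lemma partition_of_mono:
  assumes "partition_of t n p" and "i \<le> j" and "j \<le> n"
  shows "p i \<le> p j"
  using assms(2,3)
proof (induction j rule: dec_induct)
  case (step j)
  then show ?case
    using partition_ofD(3)[OF assms(1), of j] by simp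
qed simp

lemma partition_of_nonneg: "partition_of t n p \<Longrightarrow> i \<le> n \<Longrightarrow> 0 \<le> p i"
  using partition_of_mono[of t n p 0 i] by (simp add: partition_ofD(1))

lemma step_variance_nonneg: "partition_of t n p \<Longrightarrow> 0 \<le> step_variance n p c"
  unfolding step_variance_def by (intro sum_nonneg) (simp add: partition_ofD(3))

lemma step_function_power2:
  assumes "partition_of t n p"
  shows "(step_function n p c s)\<^sup>2 = step_function n p (\<lambda>i. (c i)\<^sup>2) s"
proof -
  have "(step_function k p c s)\<^sup>2 = step_function k p (\<lambda>i. (c i)\<^sup>2) s" if "k \<le> n" for k
    using that
  proof (induction k)
    case (Suc k)
    have "step_function k p c s = 0" if "s \<in> {p k<..p (Suc k)}"
      unfolding step_function_def
    proof (rule sum.neutral, rule ballI)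
      fix i assume "i \<in> {..<k}"
      then have "p (Suc i) \<le> p k"
        using Suc.prems by (intro partition_of_mono[OF assms]) auto
      with that show "c i * indicator {p i<..p (Suc i)} s = 0"
        by (auto simp: indicator_def)
    qed
    moreover have "step_function (Suc k) p d s =
        step_function k p d s + d k * indicator {p k<..p (Suc k)} s" for d
      by (simp add: step_function_def)
    ultimately show ?case
      using Suc by (auto simp: indicator_def power2_eq_square)
  qed (simp add: step_function_def)
  then show ?thesis by simp
qed

lemma step_function_const:
  assumes "partition_of t n p"
  shows "step_function n p (\<lambda>_. 1) s = indicator {0<..t} s"
proof -
  have "step_function k p (\<lambda>_. 1) s = indicator {0<..p k} s" if "k \<le> n" for k
    using that
  proof (induction k)
    case 0
    then show ?case by (simp add: step_function_def partition_ofD(1)[OF assms])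
  next
    case (Suc k)
    then have "0 \<le> p k" "p k \<le> p (Suc k)"
      using partition_of_nonneg[OF assms, of k] partition_ofD(3)[OF assms, of k] by auto
    with Suc show ?case
      by (auto simp: step_function_def indicator_def)
  qed
  from this[of n] show ?thesis
    by (simp add: partition_ofD(2)[OF assms])
qed

text \<open>The intervals of a partition are disjoint, so the square acts on the coefficients alone. Together
  with \<open>distr_step_integral\<close> below this is the Ito isometry for step functions.\<close>

lemma nn_integral_step_function_power2:
  assumes "partition_of t n p"
  shows "(\<integral>\<^sup>+s\<in>{0..t}. ennreal ((step_function n p c s)\<^sup>2) \<partial>lborel) = ennreal (step_variance n p c)"
proof -
  have "ennreal ((step_function n p c s)\<^sup>2) * indicator {0..t} s =
      (\<Sum>i<n. ennreal ((c i)\<^sup>2) * indicator {p i<..p (Suc i)} s)" for s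
  proof -
    have "c i * indicator {p i<..p (Suc i)} s = 0" if "i < n" "s \<notin> {0..t}" for i and c :: "nat \<Rightarrow> real"
      using that partition_of_nonneg[OF assms, of i] partition_of_mono[OF assms, of "Suc i" n]
      by (auto simp: indicator_def partition_ofD(2)[OF assms])
    then have "step_function n p (\<lambda>i. (c i)\<^sup>2) s = 0" if "s \<notin> {0..t}"
      unfolding step_function_def using that by (intro sum.neutral) auto
    then have "ennreal ((step_function n p c s)\<^sup>2) * indicator {0..t} s =
        ennreal (step_function n p (\<lambda>i. (c i)\<^sup>2) s)"
      by (cases "s \<in> {0..t}") (auto simp: step_function_power2[OF assms])
    also have "\<dots> = (\<Sum>i<n. ennreal ((c i)\<^sup>2 * indicator {p i<..p (Suc i)} s))"
      unfolding step_function_def by (rule sum_ennreal[symmetric]) simp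
    finally show ?thesis
      by (simp add: ennreal_mult ennreal_indicator)
  qed
  then have "(\<integral>\<^sup>+s\<in>{0..t}. ennreal ((step_function n p c s)\<^sup>2) \<partial>lborel) =
      (\<integral>\<^sup>+s. (\<Sum>i<n. ennreal ((c i)\<^sup>2) * indicator {p i<..p (Suc i)} s) \<partial>lborel)"
    by simp
  also have "\<dots> = (\<Sum>i<n. ennreal ((c i)\<^sup>2) * emeasure lborel {p i<..p (Suc i)})"
    by (subst nn_integral_sum) (auto simp: nn_integral_cmult_indicator)
  also have "\<dots> = (\<Sum>i<n. ennreal ((c i)\<^sup>2 * (p (Suc i) - p i)))"
    by (intro sum.cong) (auto simp: partition_ofD(3)[OF assms] ennreal_mult)
  also have "\<dots> = ennreal (step_variance n p c)"
    unfolding step_variance_def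
    by (rule sum_ennreal) (simp add: partition_ofD(3)[OF assms])
  finally show ?thesis .
qed

text \<open>As the Wiener integral of the constant \<open>1\<close> is \<open>W\<^sub>t - W\<^sub>0\<close>, subtracting a Wiener integral from \<open>W\<^sub>t\<close>
  means replacing the integrand \<open>f\<close> by \<open>1 - f\<close>; the next two lemmas do this for step functions.\<close>

lemma step_integral_one_minus:
  assumes "partition_of t n p"
  shows "step_integral W n p (\<lambda>i. 1 - c i) \<omega> = W t \<omega> - W 0 \<omega> - step_integral W n p c \<omega>"
proof -
  have "(\<Sum>i<n. W (p (Suc i)) \<omega> - W (p i) \<omega>) = W t \<omega> - W 0 \<omega>"
    using sum_lessThan_telescope[of "\<lambda>i. W (p i) \<omega>" n] partition_ofD[OF assms] by simp
  then show ?thesis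
    by (simp add: step_integral_def left_diff_distrib sum_subtractf)
qed

lemma step_function_one_minus:
  assumes "partition_of t n p"
  shows "step_function n p (\<lambda>i. 1 - c i) s = indicator {0<..t} s - step_function n p c s"
  using step_function_const[OF assms, of s]
  by (simp add: step_function_def left_diff_distrib sum_subtractf)

text \<open>A weight \<open>\<delta>\<close> near \<open>0\<close> keeps the factor of \<open>x\<^sup>2\<close> close to \<open>1\<close>, which suits a main term \<open>x\<close> and a
  small error \<open>y\<close>.\<close>

lemma power2_sum_le_weighted:
  fixes x y :: real
  assumes "0 < \<delta>"
  shows "(x + y)\<^sup>2 \<le> (1 + \<delta>) * x\<^sup>2 + (1 + 1 / \<delta>) * y\<^sup>2"
proof -
  have "0 \<le> (\<delta> * x - y)\<^sup>2 / \<delta>"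
    using assms by simp
  also have "\<dots> = \<delta> * x\<^sup>2 - 2 * x * y + 1 / \<delta> * y\<^sup>2"
    using assms by (simp add: field_simps power2_eq_square)
  finally show ?thesis
    by (simp add: power2_sum distrib_right)
qed

context standard_wiener_process
begin

lemma char_increment:
  assumes "0 \<le> s" and "s \<le> t"
  shows "char (distr M borel (\<lambda>\<omega>. W t \<omega> - W s \<omega>)) u = of_real (exp (- (u\<^sup>2 * (t - s)) / 2))"
proof (cases "s = t")
  case True
  then show ?thesis
    by (simp add: char_def integral_distr prob_space del: distr_const)
next
  case False
  define \<sigma> where "\<sigma> = sqrt (t - s)"
  have \<sigma>: "0 < \<sigma>" "\<sigma>\<^sup>2 = t - s"
    using False assms by (auto simp: \<sigma>_def)
  define Z where "Z \<omega> = (W t \<omega> - W s \<omega>) / \<sigma>" for \<omega>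
  have "distributed M lborel (\<lambda>\<omega>. W t \<omega> - W s \<omega>) (normal_density 0 \<sigma>)"
    using wiener_normal_increments[of s t] False assms by (simp add: \<sigma>_def)
  then have Z: "distributed M lborel Z std_normal_density"
    using normal_standard_normal_convert[OF \<sigma>(1), of "\<lambda>\<omega>. W t \<omega> - W s \<omega>" 0]
    by (simp add: Z_def[abs_def])
  have "distr M borel Z = std_normal_distribution"
    using distributed_distr_eq_density[OF Z] distr_cong[of M M lborel borel Z Z] by simp
  moreover have "Z \<in> borel_measurable M"
    using distributed_measurable[OF Z] by simp
  moreover have "(\<lambda>\<omega>. W t \<omega> - W s \<omega>) = (\<lambda>\<omega>. 0 + \<sigma> * Z \<omega>)"
    using \<sigma> by (simp add: Z_def)
  ultimately show ?thesis
    using char_distr_affine[of Z 0 \<sigma> u]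
    by (simp add: char_std_normal_distribution power_mult_distrib \<sigma>(2))
qed

lemma measurable_step_integral:
  assumes "partition_of t n p"
  shows "step_integral W n p c \<in> borel_measurable M"
proof -
  have "W (p i) \<in> borel_measurable M" if "i \<le> n" for i
    using that partition_of_nonneg[OF assms] by (intro wiener_measurable) auto
  then show ?thesis
    unfolding step_integral_def[abs_def]
    by (intro borel_measurable_sum borel_measurable_times borel_measurable_diff) auto
qed

text \<open>The characteristic function covers the degenerate cases (empty intervals of the partition,
  vanishing coefficients), in which there is no density, along with all the others.\<close>

lemma distr_step_integral:
  assumes "partition_of t n p"
  shows "distr M borel (\<lambda>\<omega>. m + step_integral W n p c \<omega>) =
    distr std_normal_distribution borel (\<lambda>z. m + sqrt (step_variance n p c) * z)"
proof (rule distr_eq_std_normal_affineI)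
  note p = partition_ofD[OF assms]
  show "(\<lambda>\<omega>. m + step_integral W n p c \<omega>) \<in> borel_measurable M"
    using measurable_step_integral[OF assms] by simp
  fix u
  let ?X = "\<lambda>i \<omega>. W (p (Suc i)) \<omega> - W (p i) \<omega>"
  have indep: "indep_vars (\<lambda>_. borel) (\<lambda>i \<omega>. c i * ?X i \<omega>) {..<n}"
    using p by (intro indep_vars_compose2[OF wiener_indep_increments, where Y="\<lambda>i x. c i * x"]) auto
  have [measurable]: "?X i \<in> borel_measurable M" if "i < n" for i
    using that partition_of_nonneg[OF assms] by (intro borel_measurable_diff wiener_measurable) auto
  have "char (distr M borel (\<lambda>\<omega>. m + step_integral W n p c \<omega>)) u =
      iexp (u * m) * char (distr M borel (step_integral W n p c)) u"
    using char_distr_affine[OF measurable_step_integral[OF assms], of m 1 c u] by simp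
  also have "char (distr M borel (step_integral W n p c)) u =
      (\<Prod>i<n. char (distr M borel (\<lambda>\<omega>. c i * ?X i \<omega>)) u)"
    unfolding step_integral_def[abs_def] by (rule char_distr_sum[OF indep])
  also have "\<dots> = (\<Prod>i<n. of_real (exp (- ((u * c i)\<^sup>2 * (p (Suc i) - p i)) / 2)))"
  proof (intro prod.cong refl)
    fix i assume "i \<in> {..<n}"
    then have i: "i < n" by simp
    show "char (distr M borel (\<lambda>\<omega>. c i * ?X i \<omega>)) u =
        of_real (exp (- ((u * c i)\<^sup>2 * (p (Suc i) - p i)) / 2))"
      using char_distr_affine[of "?X i" 0 "c i" u] i
        char_increment[of "p i" "p (Suc i)" "u * c i"] partition_of_nonneg[OF assms, of i] p(3)[of i]
      by simp
  qed
  also have "\<dots> = of_real (exp (\<Sum>i<n. - ((u * c i)\<^sup>2 * (p (Suc i) - p i)) / 2))"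
    by (simp add: exp_sum)
  also have "(\<Sum>i<n. - ((u * c i)\<^sup>2 * (p (Suc i) - p i)) / 2) = - (u\<^sup>2 * step_variance n p c) / 2"
    unfolding step_variance_def sum_distrib_left sum_negf[symmetric] sum_divide_distrib
    by (intro sum.cong) (simp_all add: power_mult_distrib)
  finally show "char (distr M borel (\<lambda>\<omega>. m + step_integral W n p c \<omega>)) u =
      iexp (u * m) * of_real (exp (- (u\<^sup>2 * (sqrt (step_variance n p c))\<^sup>2) / 2))"
    by (simp add: step_variance_nonneg[OF assms])
qed

lemma
  assumes "partition_of t n p"
  shows integrable_step_integral: "integrable M (\<lambda>\<omega>. m + step_integral W n p c \<omega>)" (is ?int)
    and abs_moment_step_integral: "(\<integral>\<omega>. \<bar>m + step_integral W n p c \<omega>\<bar> \<partial>M) =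
      std_normal_abs_moment m (sqrt (step_variance n p c))" (is ?mom)
proof -
  have [measurable]: "step_integral W n p c \<in> borel_measurable M"
    by (rule measurable_step_integral[OF assms])
  have "integrable (distr std_normal_distribution borel (\<lambda>z. m + sqrt (step_variance n p c) * z)) (\<lambda>x. x)"
    using integrable_std_normal_affine by (subst integrable_distr_eq) auto
  then have "integrable (distr M borel (\<lambda>\<omega>. m + step_integral W n p c \<omega>)) (\<lambda>x. x)"
    by (simp add: distr_step_integral[OF assms])
  then show ?int
    by (subst (asm) integrable_distr_eq) auto
  have "(\<integral>\<omega>. \<bar>m + step_integral W n p c \<omega>\<bar> \<partial>M) =
      (\<integral>x. \<bar>x\<bar> \<partial>distr M borel (\<lambda>\<omega>. m + step_integral W n p c \<omega>))"
    by (subst integral_distr) auto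
  also have "\<dots> = (\<integral>x. \<bar>x\<bar> \<partial>distr std_normal_distribution borel
      (\<lambda>z. m + sqrt (step_variance n p c) * z))"
    by (simp add: distr_step_integral[OF assms])
  also have "\<dots> = std_normal_abs_moment m (sqrt (step_variance n p c))"
    unfolding std_normal_abs_moment_def by (subst integral_distr) auto
  finally show ?mom .
qed

section \<open>Passing to the limit in the Wiener integral\<close>

text \<open>The bound \<open>v\<close> exceeds \<open>\<integral>\<^sub>0\<^sup>t (1 - f)\<^sup>2\<close> strictly, so that it also bounds the variances of the
  step approximations \<open>W\<^sub>t - S\<^sub>k\<close> for large \<open>k\<close>. These approach \<open>W\<^sub>t - I\<close> in \<open>L\<^sup>1\<close>, because
  \<open>\<bar>y\<bar> \<le> \<epsilon> + y\<^sup>2 / \<epsilon>\<close> reduces the convergence in \<open>L\<^sup>1\<close> to that in \<open>L\<^sup>2\<close>.\<close>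

lemma abs_moment_wiener_integral_le:
  assumes I: "has_wiener_integral M W t f I"
    and var: "(\<integral>\<^sup>+s\<in>{0..t}. ennreal ((1 - f s)\<^sup>2) \<partial>lborel) \<le> ennreal a"
    and a: "0 \<le> a" "a < v"
  shows "(\<integral>\<omega>. \<bar>m + W t \<omega> - I \<omega>\<bar> \<partial>M) \<le> std_normal_abs_moment m (sqrt v)"
proof -
  from I obtain n p c where [measurable]: "set_borel_measurable lborel {0..t} f"
    and Im[measurable]: "I \<in> borel_measurable M"
    and part: "\<And>k::nat. partition_of t (n k) (p k)"
    and f_lim: "(\<lambda>k. \<integral>\<^sup>+s\<in>{0..t}. ennreal ((step_function (n k) (p k) (c k) s - f s)\<^sup>2) \<partial>lborel)
          \<longlonglongrightarrow> 0"
    and I_lim: "(\<lambda>k. \<integral>\<^sup>+\<omega>. ennreal ((step_integral W (n k) (p k) (c k) \<omega> - I \<omega>)\<^sup>2) \<partial>M)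
          \<longlonglongrightarrow> 0"
    unfolding has_wiener_integral_def by blast
  have fm: "(\<lambda>s. indicator {0..t} s * f s) \<in> borel_measurable lborel"
    using \<open>set_borel_measurable lborel {0..t} f\<close> by (simp add: set_borel_measurable_def)
  define V where "V k = step_variance (n k) (p k) (\<lambda>i. 1 - c k i)" for k
  \<comment> \<open>Half of the gap between \<open>a\<close> and \<open>v\<close> absorbs the factor \<open>1 + \<delta>\<close>, the other half the error term.\<close>
  define \<delta> where "\<delta> = (v - a) / (2 * (a + 1))"
  have \<delta>: "0 < \<delta>" "(1 + \<delta>) * a \<le> (v + a) / 2"
  proof -
    show "0 < \<delta>" using a by (simp add: \<delta>_def)
    have "\<delta> * (a + 1) = (v - a) / 2" using a by (simp add: \<delta>_def field_simps)
    with \<open>0 < \<delta>\<close> show "(1 + \<delta>) * a \<le> (v + a) / 2" by (simp add: algebra_simps)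
  qed
  define \<eta> where "\<eta> = (v - a) / 2 / (1 + 1 / \<delta>)"
  have \<eta>: "0 < \<eta>" "(1 + 1 / \<delta>) * \<eta> = (v - a) / 2"
  proof -
    have *: "0 < 1 + 1 / \<delta>" using \<delta>(1) by (simp add: add_pos_pos)
    show "0 < \<eta>"
      unfolding \<eta>_def using a * by (intro divide_pos_pos) auto
    show "(1 + 1 / \<delta>) * \<eta> = (v - a) / 2"
    proof -
      have "x * (y / x) = y" if "0 < x" for x y :: real using that by simp
      from this[OF *] show ?thesis unfolding \<eta>_def .
    qed
  qed
  have ev_V: "\<forall>\<^sub>F k in sequentially. V k \<le> v"
  proof -
    have "\<forall>\<^sub>F k in sequentially.
        (\<integral>\<^sup>+s\<in>{0..t}. ennreal ((step_function (n k) (p k) (c k) s - f s)\<^sup>2) \<partial>lborel) < ennreal \<eta>"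
      using \<eta>(1) by (intro order_tendstoD(2)[OF f_lim]) simp
    then show ?thesis
    proof eventually_elim
      case (elim k)
      let ?S = "step_function (n k) (p k) (c k)"
      have [measurable]: "?S \<in> borel_measurable lborel"
        unfolding step_function_def[abs_def] by measurable
      have m1[measurable]: "(\<lambda>s. ennreal ((1 - f s)\<^sup>2) * indicator {0..t} s) \<in> borel_measurable lborel"
      proof -
        have "(\<lambda>s. ennreal ((1 - indicator {0..t} s * f s)\<^sup>2) * indicator {0..t} s) \<in> borel_measurable lborel"
          using fm by measurable
        also have "(\<lambda>s. ennreal ((1 - indicator {0..t} s * f s)\<^sup>2) * indicator {0..t} s) =
            (\<lambda>s. ennreal ((1 - f s)\<^sup>2) * indicator {0..t} s)"
          by (auto simp: indicator_def)
        finally show ?thesis .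
      qed
      have m2[measurable]: "(\<lambda>s. ennreal ((?S s - f s)\<^sup>2) * indicator {0..t} s) \<in> borel_measurable lborel"
      proof -
        have "(\<lambda>s. ennreal ((?S s - indicator {0..t} s * f s)\<^sup>2) * indicator {0..t} s) \<in> borel_measurable lborel"
          using fm by measurable
        also have "(\<lambda>s. ennreal ((?S s - indicator {0..t} s * f s)\<^sup>2) * indicator {0..t} s) =
            (\<lambda>s. ennreal ((?S s - f s)\<^sup>2) * indicator {0..t} s)"
          by (auto simp: indicator_def)
        finally show ?thesis .
      qed
      have young: "(1 - ?S s)\<^sup>2 \<le> (1 + \<delta>) * (1 - f s)\<^sup>2 + (1 + 1 / \<delta>) * (?S s - f s)\<^sup>2" for s
        using power2_sum_le_weighted[OF \<delta>(1), of "1 - f s" "f s - ?S s"]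
        by (simp add: power2_commute[of "?S s" "f s"])
      have "ennreal (V k) = (\<integral>\<^sup>+s\<in>{0..t}.
          ennreal ((step_function (n k) (p k) (\<lambda>i. 1 - c k i) s)\<^sup>2) \<partial>lborel)"
        unfolding V_def by (rule nn_integral_step_function_power2[OF part, symmetric])
      also have "\<dots> \<le> (\<integral>\<^sup>+s. ennreal (1 + \<delta>) * (ennreal ((1 - f s)\<^sup>2) * indicator {0..t} s) +
          ennreal (1 + 1 / \<delta>) * (ennreal ((?S s - f s)\<^sup>2) * indicator {0..t} s) \<partial>lborel)"
      proof (rule nn_integral_mono_AE)
        \<comment> \<open>The intervals of a step function are open on the left, so \<open>0\<close> lies in none of them.\<close>
        have "AE s in lborel. s \<noteq> (0::real)"
          by (rule AE_lborel_singleton)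
        then show "AE s in lborel.
            ennreal ((step_function (n k) (p k) (\<lambda>i. 1 - c k i) s)\<^sup>2) * indicator {0..t} s \<le>
            ennreal (1 + \<delta>) * (ennreal ((1 - f s)\<^sup>2) * indicator {0..t} s) +
            ennreal (1 + 1 / \<delta>) * (ennreal ((?S s - f s)\<^sup>2) * indicator {0..t} s)"
        proof eventually_elim
          case (elim s)
          show ?case
          proof (cases "s \<in> {0..t}")
            case True
            then have "step_function (n k) (p k) (\<lambda>i. 1 - c k i) s = 1 - ?S s"
              using elim by (simp add: step_function_one_minus[OF part] indicator_def)
            then have "ennreal ((step_function (n k) (p k) (\<lambda>i. 1 - c k i) s)\<^sup>2) \<le>
                ennreal ((1 + \<delta>) * (1 - f s)\<^sup>2 + (1 + 1 / \<delta>) * (?S s - f s)\<^sup>2)"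
              using young by (simp add: ennreal_leI)
            also have "\<dots> = ennreal (1 + \<delta>) * ennreal ((1 - f s)\<^sup>2) +
                ennreal (1 + 1 / \<delta>) * ennreal ((?S s - f s)\<^sup>2)"
              using \<delta>(1) by (simp add: ennreal_plus ennreal_mult del: ennreal_plus[symmetric])
            finally show ?thesis using True by simp
          qed simp
        qed
      qed
      also have "\<dots> = ennreal (1 + \<delta>) * (\<integral>\<^sup>+s\<in>{0..t}. ennreal ((1 - f s)\<^sup>2) \<partial>lborel) +
          ennreal (1 + 1 / \<delta>) * (\<integral>\<^sup>+s\<in>{0..t}. ennreal ((?S s - f s)\<^sup>2) \<partial>lborel)"
        by (simp add: nn_integral_add nn_integral_cmult)
      also have "\<dots> \<le> ennreal (1 + \<delta>) * ennreal a + ennreal (1 + 1 / \<delta>) * ennreal \<eta>"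
        using var elim by (intro add_mono mult_left_mono) auto
      also have "\<dots> = ennreal ((1 + \<delta>) * a + (1 + 1 / \<delta>) * \<eta>)"
        using \<delta>(1) a \<eta>(1) by (simp add: ennreal_mult[symmetric] ennreal_plus[symmetric] del: ennreal_plus)
      also have "\<dots> \<le> ennreal v"
        using \<delta>(2) \<eta>(2) by (intro ennreal_leI) (simp add: field_simps)
      finally show ?case using a by (simp add: ennreal_le_iff)
    qed
  qed
  have Wm[measurable]: "W t \<in> borel_measurable M"
    using partition_of_nonneg[OF part, of "n 0" 0] partition_ofD(2)[OF part, of 0]
    by (intro wiener_measurable) auto
  have approx: "(\<integral>\<^sup>+\<omega>. ennreal \<bar>m + W t \<omega> - I \<omega>\<bar> \<partial>M) \<le>
      ennreal (std_normal_abs_moment m (sqrt v) + \<epsilon>)"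
    if "0 < \<epsilon>" for \<epsilon>
  proof -
    \<comment> \<open>With \<open>E (S\<^sub>k - I)\<^sup>2 \<le> e\<^sup>2\<close>, both terms of \<open>e + E (S\<^sub>k - I)\<^sup>2 / e\<close> are at most \<open>e\<close>.\<close>
    define e where "e = \<epsilon> / 2"
    have e: "0 < e" using that by (simp add: e_def)
    have "\<forall>\<^sub>F k in sequentially.
        (\<integral>\<^sup>+\<omega>. ennreal ((step_integral W (n k) (p k) (c k) \<omega> - I \<omega>)\<^sup>2) \<partial>M) < ennreal (e\<^sup>2)"
      using e by (intro order_tendstoD(2)[OF I_lim]) simp
    with ev_V have "\<forall>\<^sub>F k in sequentially. V k \<le> v \<and>
        (\<integral>\<^sup>+\<omega>. ennreal ((step_integral W (n k) (p k) (c k) \<omega> - I \<omega>)\<^sup>2) \<partial>M) < ennreal (e\<^sup>2)"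
      by eventually_elim simp
    then obtain k where k: "V k \<le> v"
      "(\<integral>\<^sup>+\<omega>. ennreal ((step_integral W (n k) (p k) (c k) \<omega> - I \<omega>)\<^sup>2) \<partial>M) < ennreal (e\<^sup>2)"
      using eventually_happens'[OF sequentially_bot] by blast
    let ?S = "step_integral W (n k) (p k) (c k)"
    let ?D = "step_integral W (n k) (p k) (\<lambda>i. 1 - c k i)"
    have [measurable]: "?S \<in> borel_measurable M" "?D \<in> borel_measurable M"
      by (rule measurable_step_integral[OF part])+
    have young: "\<bar>y\<bar> \<le> e + 1 / e * y\<^sup>2" for y
    proof (cases "\<bar>y\<bar> \<le> e")
      case True
      then show ?thesis using e by (simp add: add_increasing2)
    next
      case False
      then have "\<bar>y\<bar> * e \<le> \<bar>y\<bar> * \<bar>y\<bar>" by (intro mult_left_mono) auto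
      then show ?thesis using e by (simp add: field_simps power2_eq_square add_increasing)
    qed
    have "(\<integral>\<^sup>+\<omega>. ennreal \<bar>m + W t \<omega> - I \<omega>\<bar> \<partial>M) \<le>
        (\<integral>\<^sup>+\<omega>. ennreal \<bar>m + ?D \<omega>\<bar> + (ennreal e + ennreal (1 / e) * ennreal ((?S \<omega> - I \<omega>)\<^sup>2)) \<partial>M)"
    proof (rule nn_integral_mono_AE, use wiener_zero in eventually_elim)
      case (elim \<omega>)
      have "m + W t \<omega> - I \<omega> = (m + ?D \<omega>) + (?S \<omega> - I \<omega>)"
        using elim by (simp add: step_integral_one_minus[OF part])
      then have "\<bar>m + W t \<omega> - I \<omega>\<bar> \<le> \<bar>m + ?D \<omega>\<bar> + (e + 1 / e * (?S \<omega> - I \<omega>)\<^sup>2)"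
        using young[of "?S \<omega> - I \<omega>"] abs_triangle_ineq[of "m + ?D \<omega>" "?S \<omega> - I \<omega>"] by linarith
      then have "ennreal \<bar>m + W t \<omega> - I \<omega>\<bar> \<le> ennreal (\<bar>m + ?D \<omega>\<bar> + (e + 1 / e * (?S \<omega> - I \<omega>)\<^sup>2))"
        by (rule ennreal_leI)
      also have "\<dots> = ennreal \<bar>m + ?D \<omega>\<bar> + (ennreal e + ennreal (1 / e * (?S \<omega> - I \<omega>)\<^sup>2))"
        using e by (simp add: ennreal_plus)
      also have "ennreal (1 / e * (?S \<omega> - I \<omega>)\<^sup>2) = ennreal (1 / e) * ennreal ((?S \<omega> - I \<omega>)\<^sup>2)"
        using e by (intro ennreal_mult) auto
      finally show ?case .
    qed
    also have "\<dots> = (\<integral>\<^sup>+\<omega>. ennreal \<bar>m + ?D \<omega>\<bar> \<partial>M) +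
        (ennreal e + ennreal (1 / e) * (\<integral>\<^sup>+\<omega>. ennreal ((?S \<omega> - I \<omega>)\<^sup>2) \<partial>M))"
      by (simp add: nn_integral_add nn_integral_cmult emeasure_space_1)
    also have "(\<integral>\<^sup>+\<omega>. ennreal \<bar>m + ?D \<omega>\<bar> \<partial>M) = ennreal (std_normal_abs_moment m (sqrt (V k)))"
      using integrable_step_integral[OF part] abs_moment_step_integral[OF part]
      by (subst nn_integral_eq_integral) (auto simp: V_def)
    also have "\<dots> \<le> ennreal (std_normal_abs_moment m (sqrt v))"
      using k(1) step_variance_nonneg[OF part]
      by (intro ennreal_leI std_normal_abs_moment_mono) (auto simp: V_def)
    also have "(\<integral>\<^sup>+\<omega>. ennreal ((?S \<omega> - I \<omega>)\<^sup>2) \<partial>M) \<le> ennreal (e\<^sup>2)"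
      using k(2) by simp
    also have "ennreal (1 / e) * ennreal (e\<^sup>2) = ennreal e"
      using e by (simp add: ennreal_mult[symmetric] power2_eq_square)
    also have "ennreal (std_normal_abs_moment m (sqrt v)) + (ennreal e + ennreal e) =
        ennreal (std_normal_abs_moment m (sqrt v) + \<epsilon>)"
      using e by (simp add: e_def std_normal_abs_moment_nonneg flip: ennreal_plus)
    finally show ?thesis
      by (simp add: add_left_mono mult_left_mono)
  qed
  have "(\<integral>\<^sup>+\<omega>. ennreal \<bar>m + W t \<omega> - I \<omega>\<bar> \<partial>M) \<le> ennreal (std_normal_abs_moment m (sqrt v))"
  proof (rule ennreal_le_epsilon)
    fix \<epsilon> :: real assume "0 < \<epsilon>"
    with approx[OF this] ennreal_plus[OF std_normal_abs_moment_nonneg[of m "sqrt v"], of \<epsilon>]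
    show "(\<integral>\<^sup>+\<omega>. ennreal \<bar>m + W t \<omega> - I \<omega>\<bar> \<partial>M) \<le>
        ennreal (std_normal_abs_moment m (sqrt v)) + ennreal \<epsilon>"
      by (simp only: less_imp_le)
  qed
  then have "enn2real (\<integral>\<^sup>+\<omega>. ennreal \<bar>m + W t \<omega> - I \<omega>\<bar> \<partial>M) \<le> std_normal_abs_moment m (sqrt v)"
    by (rule enn2real_leI[OF std_normal_abs_moment_nonneg])
  then show ?thesis
    by (subst integral_eq_nn_integral) simp_all
qed

section \<open>The three versions of the bridge\<close>

lemma abs_moment_bridge_av:
  assumes "0 < T"
  shows "(\<integral>\<omega>. \<bar>W t \<omega> - bridge_av T b W t \<omega>\<bar> \<partial>M) =
    std_normal_abs_moment (- b * (t / T)) (sqrt (t\<^sup>2 / T))"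
proof -
  define p where "p i = (if i = 0 then 0 else T)" for i :: nat
  define c where "c = (\<lambda>i::nat. t / T)"
  have part: "partition_of T 1 p"
    using assms by (simp add: partition_of_def p_def)
  have Wm: "W T \<in> borel_measurable M" "W 0 \<in> borel_measurable M"
    using assms by (auto intro!: wiener_measurable)
  have "(\<integral>\<omega>. \<bar>W t \<omega> - bridge_av T b W t \<omega>\<bar> \<partial>M) =
      (\<integral>\<omega>. \<bar>t / T * W T \<omega> - b * (t / T)\<bar> \<partial>M)"
    by (simp add: bridge_av_def)
  also have "\<dots> = (\<integral>\<omega>. \<bar>- b * (t / T) + step_integral W 1 p c \<omega>\<bar> \<partial>M)"
  proof (rule integral_cong_AE)
    show "AE \<omega> in M. \<bar>t / T * W T \<omega> - b * (t / T)\<bar> = \<bar>- b * (t / T) + step_integral W 1 p c \<omega>\<bar>"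
      using wiener_zero by eventually_elim (simp add: step_integral_def p_def c_def)
  qed (use Wm measurable_step_integral[OF part] in measurable)
  also have "step_variance 1 p c = t\<^sup>2 / T"
    using assms by (simp add: step_variance_def p_def c_def power2_eq_square)
  with abs_moment_step_integral[OF part, of "- b * (t / T)" c]
  have "(\<integral>\<omega>. \<bar>- b * (t / T) + step_integral W 1 p c \<omega>\<bar> \<partial>M) =
      std_normal_abs_moment (- b * (t / T)) (sqrt (t\<^sup>2 / T))"
    by simp
  finally show ?thesis .
qed

lemma abs_moment_bridge_st:
  assumes "0 < t" and "t < T"
  shows "(\<integral>\<omega>. \<bar>W t \<omega> - bridge_st T b W t \<omega>\<bar> \<partial>M) =
    std_normal_abs_moment (- b * (t / T)) (sqrt (t\<^sup>2 / T))"
proof -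
  define u where "u = t * T / (T - t)"
  have u: "t \<le> u" "u - t = t\<^sup>2 / (T - t)"
  proof -
    show "u - t = t\<^sup>2 / (T - t)"
      using assms by (simp add: u_def field_simps power2_eq_square)
    moreover have "0 \<le> t\<^sup>2 / (T - t)" using assms by simp
    ultimately show "t \<le> u" by linarith
  qed
  define p where "p i = (if i = 0 then 0 else if i = 1 then t else u)" for i :: nat
  define c where "c i = (if i = 0 then t / T else - ((T - t) / T))" for i :: nat
  have part: "partition_of u 2 p"
    using assms u by (simp add: partition_of_def p_def less_2_cases_iff)
  have Wm: "W t \<in> borel_measurable M" "W u \<in> borel_measurable M"
    using assms u by (auto intro!: wiener_measurable)
  have "(\<integral>\<omega>. \<bar>W t \<omega> - bridge_st T b W t \<omega>\<bar> \<partial>M) =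
      (\<integral>\<omega>. \<bar>W t \<omega> - (b * (t / T) + (T - t) / T * W u \<omega>)\<bar> \<partial>M)"
    using assms by (simp add: bridge_st_def u_def)
  also have "\<dots> = (\<integral>\<omega>. \<bar>- b * (t / T) + step_integral W 2 p c \<omega>\<bar> \<partial>M)"
  proof (rule integral_cong_AE)
    show "AE \<omega> in M. \<bar>W t \<omega> - (b * (t / T) + (T - t) / T * W u \<omega>)\<bar> =
        \<bar>- b * (t / T) + step_integral W 2 p c \<omega>\<bar>"
      using wiener_zero
    proof eventually_elim
      case (elim \<omega>)
      have "step_integral W 2 p c \<omega> = t / T * W t \<omega> - (T - t) / T * (W u \<omega> - W t \<omega>)"
        using elim by (simp add: step_integral_def p_def c_def numeral_2_eq_2)
      also have "\<dots> = W t \<omega> - (T - t) / T * W u \<omega>"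
        using assms by (simp add: field_simps)
      finally show ?case by (simp add: algebra_simps)
    qed
  qed (use Wm measurable_step_integral[OF part] in measurable)
  also have "step_variance 2 p c = t\<^sup>2 / T"
  proof -
    have "step_variance 2 p c = (t / T)\<^sup>2 * t + ((T - t) / T)\<^sup>2 * (u - t)"
      by (simp add: step_variance_def p_def c_def numeral_2_eq_2 power2_eq_square)
    also have "((T - t) / T)\<^sup>2 * (u - t) = (t / T)\<^sup>2 * (T - t)"
      using assms by (simp add: u(2) power_divide power2_eq_square)
    also have "(t / T)\<^sup>2 * t + (t / T)\<^sup>2 * (T - t) = (t / T)\<^sup>2 * T"
      by (simp add: right_diff_distrib)
    finally show ?thesis
      using assms by (simp add: power2_eq_square)
  qed
  with abs_moment_step_integral[OF part, of "- b * (t / T)" c]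
  have "(\<integral>\<omega>. \<bar>- b * (t / T) + step_integral W 2 p c \<omega>\<bar> \<partial>M) =
      std_normal_abs_moment (- b * (t / T)) (sqrt (t\<^sup>2 / T))"
    by simp
  finally show ?thesis .
qed

lemma abs_moment_bridge_ir_less:
  assumes ir: "is_bridge_ir M T b W X" and t: "0 < t" "t < T"
  shows "(\<integral>\<omega>. \<bar>W t \<omega> - X t \<omega>\<bar> \<partial>M) < std_normal_abs_moment (- b * (t / T)) (sqrt (t\<^sup>2 / T))"
proof -
  from t have "0 \<le> t \<and> t < T" by simp
  with ir obtain I where I: "has_wiener_integral M W t (\<lambda>s. (T - t) / (T - s)) I"
    and X: "\<And>\<omega>. \<omega> \<in> space M \<Longrightarrow> X t \<omega> = b * (t / T) + I \<omega>"
    unfolding is_bridge_ir_def by blast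
  define a where "a = (t / T)\<^sup>2 * t"
  have "a = t\<^sup>2 / T * (t / T)"
    by (simp add: a_def power2_eq_square)
  also have "\<dots> < t\<^sup>2 / T * 1"
    using t by (intro mult_strict_left_mono) auto
  finally have "a < t\<^sup>2 / T"
    by simp
  then obtain v where v: "a < v" "v < t\<^sup>2 / T"
    using dense by blast
  have a: "0 \<le> a"
    using t by (simp add: a_def)
  have bound: "(1 - (T - t) / (T - s))\<^sup>2 \<le> (t / T)\<^sup>2" if "s \<in> {0..t}" for s
  proof (rule power_mono)
    show "0 \<le> 1 - (T - t) / (T - s)"
      using that t by (simp add: field_simps)
    \<comment> \<open>The integrand decreases in \<open>s\<close>; its maximum, at \<open>s = 0\<close>, is \<open>t / T\<close>.\<close>
    have "(T - t) / T \<le> (T - t) / (T - s)"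
      using that t by (intro divide_left_mono) auto
    moreover have "(T - t) / T = 1 - t / T"
      using t by (simp add: diff_divide_distrib)
    ultimately show "1 - (T - t) / (T - s) \<le> t / T" by simp
  qed
  have "(\<integral>\<^sup>+s\<in>{0..t}. ennreal ((1 - (T - t) / (T - s))\<^sup>2) \<partial>lborel) \<le>
      (\<integral>\<^sup>+s\<in>{0..t}. ennreal ((t / T)\<^sup>2) \<partial>lborel)"
    using bound by (intro nn_integral_mono) (auto simp: indicator_def intro!: ennreal_leI)
  also have "\<dots> = ennreal a"
    using t by (simp add: a_def nn_integral_cmult_indicator ennreal_mult)
  finally have "(\<integral>\<omega>. \<bar>- b * (t / T) + W t \<omega> - I \<omega>\<bar> \<partial>M) \<le>
      std_normal_abs_moment (- b * (t / T)) (sqrt v)"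
    by (intro abs_moment_wiener_integral_le[OF I _ a v(1)])
  moreover have "(\<integral>\<omega>. \<bar>W t \<omega> - X t \<omega>\<bar> \<partial>M) = (\<integral>\<omega>. \<bar>- b * (t / T) + W t \<omega> - I \<omega>\<bar> \<partial>M)"
    by (intro Bochner_Integration.integral_cong) (auto simp: X algebra_simps)
  moreover have "std_normal_abs_moment (- b * (t / T)) (sqrt v) <
      std_normal_abs_moment (- b * (t / T)) (sqrt (t\<^sup>2 / T))"
    using a v by (intro std_normal_abs_moment_strict_mono) auto
  ultimately show ?thesis by simp
qed

end

theorem lemma2p5:
  fixes M :: "'a measure" and W W_ir :: "real \<Rightarrow> 'a \<Rightarrow> real" and T b :: real
  assumes "standard_wiener_process M W"
    and "0 < T"
    and "is_bridge_ir M T b W W_ir"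
  shows "\<forall>t\<in>{0<..<T}.
    (\<integral>\<omega>. \<bar>W t \<omega> - bridge_av T b W t \<omega>\<bar> \<partial>M) = (\<integral>\<omega>. \<bar>W t \<omega> - bridge_st T b W t \<omega>\<bar> \<partial>M) \<and>
    (\<integral>\<omega>. \<bar>W t \<omega> - bridge_st T b W t \<omega>\<bar> \<partial>M) > (\<integral>\<omega>. \<bar>W t \<omega> - W_ir t \<omega>\<bar> \<partial>M)"
proof -
  interpret standard_wiener_process M W by fact
  show ?thesis
  proof
    fix t assume "t \<in> {0<..<T}"
    then have t: "0 < t" "t < T" by auto
    note abs_moment_bridge_av[OF assms(2), of t b] abs_moment_bridge_st[OF t, of b]
      abs_moment_bridge_ir_less[OF assms(3) t]
    then show "(\<integral>\<omega>. \<bar>W t \<omega> - bridge_av T b W t \<omega>\<bar> \<partial>M) = (\<integral>\<omega>. \<bar>W t \<omega> - bridge_st T b W t \<omega>\<bar> \<partial>M) \<and>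
        (\<integral>\<omega>. \<bar>W t \<omega> - bridge_st T b W t \<omega>\<bar> \<partial>M) > (\<integral>\<omega>. \<bar>W t \<omega> - W_ir t \<omega>\<bar> \<partial>M)"
      by (simp only: simp_thms)
  qed
qed

end
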